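(* Let $X$ be a spectrally negative Lévy process and let $a>0$. For all real $y\geq x$ and all $r\geq 0$, the Parisian drawdown ruin time $\tau_r$ satisfies $\mathbb{P}_{y,x}\{\tau_r<\infty\}=1$.
   Context: $X=\{X_t:t\ge 0\}$ is a spectrally negative Lévy process (no positive jumps) with Laplace exponent $\psi(\lambda)=\frac1t\log\mathbb{E}\{e^{\lambda X_t}\}=\mu\lambda+\frac12\sigma^2\lambda^2+\int_{(-\infty,0)}(e^{\lambda x}-1-\lambda x\mathbf{1}_{\{x>-1\}})\Pi(dx)$, where $\mu\in\mathbb{R}$, $\sigma\ge 0$ and $\Pi$ is a measure on $(-\infty,0)$ with $\int(1\wedge x^2)\Pi(dx)<\infty$; $X$ does not have monotone paths, so that $\psi$ is strictly convex and $\psi(\lambda)\to\infty$ as $\lambda\to\infty$. Drawdown: $\overline{X}_t=\sup_{0\le s\le t}X_s$ and $Y_t=(\overline{X}_t\vee y)-X_t$. $\mathbb{P}_{y,x}$, $y\ge x$, is the law under which $X_0=x$ and the current maximum at time $0$ is $y$ (so $Y_0=y-x$). Ruin time: for fixed $a>0$, $\tau_r=\inf\{t>r:\ t-g_t\ge r\}$ with $g_t=\sup\{0\le s\le t:\ Y_s\le a\}$ (and $\sup\emptyset=0$), $\inf\emptyset=\infty$. *)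

theory Defs
  imports "HOL-Probability.Probability"
begin

section \<open>Levy processes\<close>

text \<open>
  Processes are indexed by \<^typ>\<open>real\<close>; only times \<open>t \<ge> 0\<close> are constrained. The starting
  point is left free, so that one notion covers the process under every initial law.
\<close>

definition cadlag :: "(real \<Rightarrow> real) \<Rightarrow> bool" where
  "cadlag f \<longleftrightarrow> (\<forall>t\<ge>0. continuous (at_right t) f) \<and> (\<forall>t>0. \<exists>l. (f \<longlongrightarrow> l) (at_left t))"

locale levy_process = prob_space M for M :: "'a measure" +
  fixes X :: "real \<Rightarrow> 'a \<Rightarrow> real"
  assumes measurable_X: "\<And>t. t \<ge> 0 \<Longrightarrow> X t \<in> borel_measurable M"
    and indep_increments:
      "\<And>(n::nat) t. 0 \<le> t 0 \<Longrightarrow> (\<And>i. i < n \<Longrightarrow> t i \<le> t (Suc i)) \<Longrightarrow>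
         indep_vars (\<lambda>_. borel) (\<lambda>i \<omega>. X (t (Suc i)) \<omega> - X (t i) \<omega>) {..<n}"
    and stationary_increments:
      "\<And>s h. s \<ge> 0 \<Longrightarrow> h \<ge> 0 \<Longrightarrow>
         distr M borel (\<lambda>\<omega>. X (s + h) \<omega> - X s \<omega>) = distr M borel (\<lambda>\<omega>. X h \<omega> - X 0 \<omega>)"
    and cadlag_paths: "AE \<omega> in M. cadlag (\<lambda>t. X t \<omega>)"

text \<open>The sigma-algebra condition also forces \<open>space \<nu> = {..<0}\<close>.\<close>

definition negative_levy_measure :: "real measure \<Rightarrow> bool" where
  "negative_levy_measure \<nu> \<longleftrightarrow>
     sets \<nu> = sets (restrict_space borel {..<0}) \<and> integrable \<nu> (\<lambda>x. min 1 (x\<^sup>2))"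

definition laplace_exponent :: "real \<Rightarrow> real \<Rightarrow> real measure \<Rightarrow> real \<Rightarrow> real" where
  "laplace_exponent \<mu> \<sigma> \<nu> l =
     \<mu> * l + \<sigma>\<^sup>2 * l\<^sup>2 / 2 + (\<integral>x. (exp (l * x) - 1 - l * x * indicat_real {-1<..} x) \<partial>\<nu>)"

text \<open>
  The Laplace exponent is that of the process started at 0, hence the increment \<open>X t - X 0\<close>.
\<close>

locale spectrally_negative_levy_process = levy_process M X
  for M :: "'a measure" and X :: "real \<Rightarrow> 'a \<Rightarrow> real" +
  fixes \<mu> \<sigma> :: real and \<nu> :: "real measure"
  assumes no_positive_jumps:
      "AE \<omega> in M. \<forall>t>0. X t \<omega> \<le> Lim (at_left t) (\<lambda>s. X s \<omega>)"
    and sigma_nonneg: "\<sigma> \<ge> 0"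
    and levy_measure: "negative_levy_measure \<nu>"
    and exponential_moments:
      "\<And>l t. l \<ge> 0 \<Longrightarrow> t \<ge> 0 \<Longrightarrow> integrable M (\<lambda>\<omega>. exp (l * (X t \<omega> - X 0 \<omega>)))"
    and laplace_exponent:
      "\<And>l t. l \<ge> 0 \<Longrightarrow> t > 0 \<Longrightarrow>
         ln (expectation (\<lambda>\<omega>. exp (l * (X t \<omega> - X 0 \<omega>)))) / t = laplace_exponent \<mu> \<sigma> \<nu> l"
    and not_increasing: "\<not> (AE \<omega> in M. mono_on {0..} (\<lambda>t. X t \<omega>))"
    and not_decreasing: "\<not> (AE \<omega> in M. antimono_on {0..} (\<lambda>t. X t \<omega>))"

section \<open>Drawdown and Parisian ruin, for a single path\<close>

definition running_sup :: "(real \<Rightarrow> real) \<Rightarrow> real \<Rightarrow> real" where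
  "running_sup f t = (SUP s\<in>{0..t}. f s)"

text \<open>\<open>y\<close> is the maximum already attained at time 0.\<close>

definition drawdown :: "real \<Rightarrow> (real \<Rightarrow> real) \<Rightarrow> real \<Rightarrow> real" where
  "drawdown y f t = max (running_sup f t) y - f t"

definition last_time_below :: "real \<Rightarrow> real \<Rightarrow> (real \<Rightarrow> real) \<Rightarrow> real \<Rightarrow> real" where
  "last_time_below a y f t =
     (let S = {s. 0 \<le> s \<and> s \<le> t \<and> drawdown y f s \<le> a} in if S = {} then 0 else Sup S)"

text \<open>The infimum is taken in \<^typ>\<open>ereal\<close>, where that of the empty set is \<open>\<infinity>\<close>.\<close>

definition parisian_ruin_time :: "real \<Rightarrow> real \<Rightarrow> real \<Rightarrow> (real \<Rightarrow> real) \<Rightarrow> ereal" where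
  "parisian_ruin_time a r y f =
     (INF t \<in> {t. t > r \<and> t - last_time_below a y f t \<ge> r}. ereal t)"

end

theory Submission
  imports Defs
begin

text \<open>
  The paths are not almost surely increasing. Hence some increment \<open>X h - X 0\<close> falls below
  \<open>- e\<close> with positive probability, for some \<open>h, e > 0\<close>. Cut time into blocks of length \<open>h\<close>, and say that a block is dropping if
  the path loses more than \<open>e\<close> over it and never rises more than \<open>\<kappa>\<close> above its value at the
  start of the block. Cadlag paths are bounded on compact intervals, so for a large \<open>\<kappa>\<close> a block is
  dropping with positive probability (\<open>ex_dropping_event_pos\<close>); by stationarity and independence
  of increments the blocks are independent trials with the same probability of success
  (\<open>prob_dropping_event\<close>, \<open>indep_dropping_event\<close>). Almost surely, some run of \<open>N + R + 1\<close>
  consecutive blocks is therefore dropping (\<open>indep_events_run\<close>).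

  After \<open>N\<close> dropping blocks the path lies more than \<open>N * e\<close> below its value at the start of the run,
  and during the remaining ones it never recovers more than \<open>\<kappa>\<close> of this. If \<open>N * e > \<kappa> + a\<close>, then
  the drawdown stays above \<open>a\<close> during a time \<open>R * h\<close>, which is at least \<open>r\<close> for a large \<open>R\<close>: this
  is Parisian ruin (\<open>parisian_ruin_of_run\<close>).

  That a block is dropping is a condition on uncountably many times. It is therefore defined through
  the times \<open>h * (b + i / 2 ^ k)\<close>. At a fixed level \<open>k\<close> it concerns finitely many increments, which
  are independent and identically distributed; the event itself is the decreasing limit of these as
  \<open>k\<close> grows, and right-continuity gives the bound at the remaining times
  (\<open>dropping_block_le\<close>).
\<close>

section \<open>Runs of successes in independent trials\<close>

text \<open>
  By the zero-one law it is enough that the limit superior of the events has positive probability,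
  and by continuity from above that probability is at least \<open>c\<close>.
\<close>

lemma (in prob_space) indep_events_infinitely_often:
  fixes F :: "nat \<Rightarrow> 'a set"
  assumes indep: "indep_events F UNIV" and c: "c > 0" "\<And>n. prob (F n) \<ge> c"
  shows "AE \<omega> in M. infinite {n. \<omega> \<in> F n}"
proof -
  have F: "F n \<in> events" for n
    using indep by (auto simp: indep_events_def)
  let ?U = "\<lambda>n. \<Union>m\<in>{n..}. F m"
  have "decseq ?U"
    unfolding decseq_def by (intro allI impI UN_mono) auto
  then have "(\<lambda>n. prob (?U n)) \<longlonglongrightarrow> prob (\<Inter>n. ?U n)"
    using F by (intro finite_Lim_measure_decseq) auto
  moreover have "c \<le> prob (?U n)" for n
    using c(2)[of n] F by (intro order_trans[OF c(2)[of n] finite_measure_mono]) auto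
  ultimately have "c \<le> prob (\<Inter>n. ?U n)"
    by (intro LIMSEQ_le_const) auto
  with borel_0_1_law[OF indep] c(1) have "prob (\<Inter>n. ?U n) = 1"
    by auto
  then have "AE \<omega> in M. \<omega> \<in> (\<Inter>n. ?U n)"
    using F by (subst (asm) prob_eq_1) auto
  then show ?thesis
    by eventually_elim (auto simp: infinite_nat_iff_unbounded_le Bex_def)
qed

text \<open>
  Disjoint windows of \<open>W\<close> consecutive trials are again independent, and each consists of successes
  only with probability at least \<open>q ^ W\<close>.
\<close>

lemma (in prob_space) indep_events_run:
  fixes D :: "nat \<Rightarrow> 'a set"
  assumes indep: "indep_events D UNIV" and q: "q > 0" "\<And>n. prob (D n) \<ge> q"
  shows "AE \<omega> in M. \<exists>n. \<forall>i<W. \<omega> \<in> D (n + i)"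
proof (cases "W = 0")
  case False
  define K where "K n = {n * W..<n * W + W}" for n
  define F where "F n = (\<Inter>b\<in>K n. D b)" for n
  have K: "finite (K n)" "K n \<noteq> {}" "card (K n) = W" for n
    using False by (auto simp: K_def)
  have disj: "K m \<inter> K n = {}" if "m \<noteq> n" for m n
  proof -
    have "b div W = n" if "b \<in> K n" for b n
      using that by (intro div_nat_eqI) (auto simp: K_def algebra_simps)
    with that show ?thesis by (metis disjoint_iff)
  qed
  have D: "D n \<in> events" for n
    using indep by (auto simp: indep_events_def)
  have prod: "prob (\<Inter>b\<in>J. D b) = (\<Prod>b\<in>J. prob (D b))" if "finite J" "J \<noteq> {}" for J
    using indep that by (auto simp: indep_events_def)
  have "indep_events F UNIV"
  proof (rule indep_eventsI)
    show "F n \<in> events" for n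
      unfolding F_def using K D by (intro sets.finite_INT) auto
    fix J :: "nat set" assume J: "finite J" "J \<noteq> {}"
    have "(\<Inter>n\<in>J. F n) = (\<Inter>b\<in>(\<Union>n\<in>J. K n). D b)"
      by (auto simp: F_def)
    also have "prob \<dots> = (\<Prod>b\<in>(\<Union>n\<in>J. K n). prob (D b))"
      using J K by (intro prod) auto
    also have "\<dots> = (\<Prod>n\<in>J. \<Prod>b\<in>K n. prob (D b))"
      using J K disj by (intro prod.UNION_disjoint) auto
    also have "\<dots> = (\<Prod>n\<in>J. prob (F n))"
      unfolding F_def using K by (simp add: prod)
    finally show "prob (\<Inter>n\<in>J. F n) = (\<Prod>n\<in>J. prob (F n))" .
  qed
  moreover have "prob (F n) \<ge> q ^ W" for n
  proof -
    have "q ^ W = (\<Prod>b\<in>K n. q)" using K by simp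
    also have "\<dots> \<le> (\<Prod>b\<in>K n. prob (D b))" using q by (intro prod_mono) (auto intro: less_imp_le)
    also have "\<dots> = prob (F n)" unfolding F_def using K by (simp add: prod)
    finally show ?thesis .
  qed
  ultimately have "AE \<omega> in M. infinite {n. \<omega> \<in> F n}"
    using q(1) by (intro indep_events_infinitely_often[where c="q ^ W"]) auto
  then show ?thesis
  proof eventually_elim
    case (elim \<omega>)
    then obtain n where "\<omega> \<in> F n"
      using infinite_imp_nonempty by blast
    then show ?case
      by (intro exI[of _ "n * W"]) (auto simp: F_def K_def)
  qed
qed auto

section \<open>Cadlag paths\<close>

text \<open>
  The one-sided limits bound the path near each time; finitely many such neighbourhoods cover the
  compact interval.
\<close>

lemma cadlag_bdd_above:
  assumes f: "cadlag f"
  shows "bdd_above (f ` {0..T})"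
proof -
  have "\<exists>U B. open U \<and> t \<in> U \<and> (\<forall>s\<in>U \<inter> {0..T}. f s \<le> B)" if t: "t \<in> {0..T}" for t
  proof -
    have "(f \<longlongrightarrow> f t) (at_right t)"
      using f t by (auto simp: cadlag_def continuous_within)
    then have "\<forall>\<^sub>F s in at_right t. f s < f t + 1"
      by (rule order_tendstoD) simp
    then obtain d where d: "d > t" "\<And>s. t < s \<Longrightarrow> s < d \<Longrightarrow> f s < f t + 1"
      by (auto simp: eventually_at_right_field)
    obtain c B where c: "c < t" "\<And>s. c < s \<Longrightarrow> s < t \<Longrightarrow> 0 \<le> s \<Longrightarrow> f s < B"
    proof (cases "t = 0")
      case True
      \<comment> \<open>There are no times to the left of \<open>0\<close>, where the path is unconstrained.\<close>
      then show ?thesis by (intro that[of "-1"]) auto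
    next
      case False
      with t have "t > 0" by simp
      then obtain l where "(f \<longlongrightarrow> l) (at_left t)"
        using f unfolding cadlag_def by blast
      then have "\<forall>\<^sub>F s in at_left t. f s < l + 1"
        by (rule order_tendstoD) simp
      then show ?thesis
        by (auto simp: eventually_at_left_field intro: that)
    qed
    have "\<forall>s\<in>{c<..<d} \<inter> {0..T}. f s \<le> max B (f t + 1)"
      using c(2) d(2) by (force simp: le_max_iff_disj intro: less_imp_le)
    then show ?thesis
      using c(1) d(1) by (intro exI[of _ "{c<..<d}"] exI[of _ "max B (f t + 1)"]) auto
  qed
  then obtain U B where U: "\<And>t. t \<in> {0..T} \<Longrightarrow> open (U t)" "\<And>t. t \<in> {0..T} \<Longrightarrow> t \<in> U t"
      "\<And>t s. t \<in> {0..T} \<Longrightarrow> s \<in> U t \<Longrightarrow> s \<in> {0..T} \<Longrightarrow> f s \<le> B t"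
    by (metis IntI)
  obtain C where C: "C \<subseteq> {0..T}" "finite C" "{0..T} \<subseteq> (\<Union>t\<in>C. U t)"
    using compactE_image[OF compact_Icc, of "{0..T}" U 0 T] U by (metis UN_I subsetI)
  show ?thesis
  proof (cases "C = {}")
    case False
    have "f s \<le> Max (B ` C)" if s: "s \<in> {0..T}" for s
    proof -
      obtain t where "t \<in> C" "s \<in> U t" using C s by auto
      then show ?thesis
        using U(3)[of t s] C s by (intro order_trans[of "f s" "B t" "Max (B ` C)"] Max_ge) auto
    qed
    then show ?thesis by (intro bdd_aboveI2)
  qed (use C in auto)
qed

section \<open>Dropping blocks of a path\<close>

lemma dyadic_between:
  fixes u v :: real
  assumes "0 \<le> u" "u < v" "v \<le> 1"
  shows "\<exists>k i. i \<le> 2 ^ k \<and> u < real i / 2 ^ k \<and> real i / 2 ^ k < v"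
proof -
  obtain k where k: "(1/2) ^ k < v - u"
    using real_arch_pow_inv[of "v - u" "1/2"] assms by auto
  define i where "i = nat (\<lfloor>u * 2 ^ k\<rfloor> + 1)"
  have "u * 2 ^ k \<ge> 0" using assms by simp
  then have ri: "real i = of_int \<lfloor>u * 2 ^ k\<rfloor> + 1"
    by (simp add: i_def)
  have 1: "u < real i / 2 ^ k"
    unfolding ri by (simp add: pos_less_divide_eq) 
  have "real i \<le> u * 2 ^ k + 1"
    unfolding ri by simp
  also have "\<dots> < v * 2 ^ k"
    using k by (simp add: field_simps power_divide)
  finally have 2: "real i / 2 ^ k < v" by (simp add: pos_divide_less_eq)
  then have "real i / 2 ^ k < 1" using assms by linarith
  then have "real i < real (2 ^ k)" by (simp add: pos_divide_less_eq)
  then have "i \<le> 2 ^ k" by (metis less_imp_le of_nat_less_iff)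
  with 1 2 show ?thesis by blast
qed

text \<open>
  Block \<open>b\<close> is the time interval from \<open>h * b\<close> to \<open>h * (b + 1)\<close>, and level \<open>k\<close> looks at it on the
  mesh \<open>h / 2 ^ k\<close>. Dyadic meshes are nested, so the condition gets stronger as \<open>k\<close> grows.
\<close>

definition dropping_at_level :: "nat \<Rightarrow> real \<Rightarrow> real \<Rightarrow> real \<Rightarrow> nat \<Rightarrow> (real \<Rightarrow> real) \<Rightarrow> bool" where
  "dropping_at_level k h e \<kappa> b f \<longleftrightarrow>
     (\<forall>i\<le>2 ^ k. f (h * (real b + real i / 2 ^ k)) - f (h * real b) \<le> \<kappa>) \<and>
     f (h * (real b + 1)) - f (h * real b) < - e"

definition dropping_block :: "real \<Rightarrow> real \<Rightarrow> real \<Rightarrow> nat \<Rightarrow> (real \<Rightarrow> real) \<Rightarrow> bool" where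
  "dropping_block h e \<kappa> b f \<longleftrightarrow> (\<forall>k. dropping_at_level k h e \<kappa> b f)"

lemma dropping_at_level_Suc:
  assumes "dropping_at_level (Suc k) h e \<kappa> b f"
  shows "dropping_at_level k h e \<kappa> b f"
proof -
  have "f (h * (real b + real i / 2 ^ k)) - f (h * real b) \<le> \<kappa>" if "i \<le> 2 ^ k" for i
  proof -
    have "f (h * (real b + real (2 * i) / 2 ^ Suc k)) - f (h * real b) \<le> \<kappa>"
      using assms that by (auto simp: dropping_at_level_def simp del: of_nat_mult)
    then show ?thesis by simp
  qed
  with assms show ?thesis by (simp add: dropping_at_level_def)
qed

text \<open>
  A path that exceeds the bound at some time before the end of the block does so just after that
  time as well, by right-continuity, and hence at a dyadic point. The end of the block is itself
  dyadic.
\<close>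

lemma dropping_block_le:
  assumes f: "cadlag f" and h: "h > 0" and D: "dropping_block h e \<kappa> b f"
    and s: "0 \<le> s" "s \<le> 1"
  shows "f (h * (real b + s)) - f (h * real b) \<le> \<kappa>"
proof (rule ccontr)
  assume neg: "\<not> ?thesis"
  let ?t = "h * (real b + s)"
  have dy: "f (h * (real b + real i / 2 ^ k)) - f (h * real b) \<le> \<kappa>" if "i \<le> 2 ^ k" for i k
    using D that by (auto simp: dropping_block_def dropping_at_level_def)
  have "s \<noteq> 1" using dy[of 1 0] neg by auto
  with s have s1: "s < 1" by simp
  have "(f \<longlongrightarrow> f ?t) (at_right ?t)"
    using f h s by (auto simp: cadlag_def continuous_within)
  then have "\<forall>\<^sub>F u in at_right ?t. f u > f (h * real b) + \<kappa>"
    using neg by (intro order_tendstoD) auto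
  then obtain d where d: "d > ?t" "\<And>u. ?t < u \<Longrightarrow> u < d \<Longrightarrow> f u > f (h * real b) + \<kappa>"
    by (auto simp: eventually_at_right_field)
  \<comment> \<open>The bound fails strictly between \<open>s\<close> and \<open>v\<close> in the coordinate of the block.\<close>
  define v where "v = min 1 (d / h - real b)"
  have "s < d / h - real b"
    using d(1) h by (simp add: field_simps)
  with s1 have "s < v" "v \<le> 1" by (auto simp: v_def)
  then obtain k i where i: "i \<le> 2 ^ k" "s < real i / 2 ^ k" "real i / 2 ^ k < v"
    using dyadic_between s by blast
  have "?t < h * (real b + real i / 2 ^ k)" using i h by simp
  moreover have "real b + real i / 2 ^ k < d / h"
    using i by (simp add: v_def)
  then have "h * (real b + real i / 2 ^ k) < d"
    using h by (simp add: field_simps)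
  ultimately show False using d(2) dy[OF i(1)] by fastforce
qed

section \<open>A long run of dropping blocks causes ruin\<close>

text \<open>
  The first \<open>N\<close> blocks bring the path down, the next \<open>R\<close> keep it down until the witness \<open>t\<close> for
  ruin, and the last one is there because \<open>t\<close> is its starting point: the drawdown must exceed \<open>a\<close>
  at \<open>t\<close> too.
\<close>

lemma parisian_ruin_of_run:
  assumes f: "cadlag f" and h: "h > 0" and e: "e > 0" and r: "r \<le> h * real R"
    and N: "N > 0" "\<kappa> + a < real N * e"
    and run: "\<And>i. i < N + R + 1 \<Longrightarrow> dropping_block h e \<kappa> (n + i) f"
  shows "parisian_ruin_time a r y f < \<infinity>"
proof -
  \<comment> \<open>Level \<open>0\<close> already contains the loss over a whole block.\<close>
  have drop: "f (h * real (n + j)) \<le> f (h * real n) - real j * e" if "j < N + R + 1" for j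
    using that
  proof (induction j)
    case (Suc j)
    then have "dropping_at_level 0 h e \<kappa> (n + j) f"
      using run[of j] by (auto simp: dropping_block_def)
    then have "f (h * real (n + Suc j)) < f (h * real (n + j)) - e"
      by (simp add: dropping_at_level_def algebra_simps)
    with Suc show ?case by (simp add: algebra_simps)
  qed simp
  define t where "t = h * real (n + N + R)"
  have far: "drawdown y f s > a" if s: "h * real (n + N) \<le> s" "s \<le> t" for s
  proof -
    define b where "b = nat \<lfloor>s / h\<rfloor>"
    have sh: "real (n + N) \<le> s / h" "s / h \<le> real (n + N + R)"
      using s h by (simp_all add: t_def field_simps)
    then have "real (n + N) \<le> of_int \<lfloor>s / h\<rfloor>"
      by (metis le_floor_iff of_int_le_iff of_int_of_nat_eq)
    moreover from this have rb: "real b = of_int \<lfloor>s / h\<rfloor>"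
      by (simp add: b_def)
    moreover have "real b \<le> real (n + N + R)"
      using sh rb of_int_floor_le[of "s / h"] by linarith
    ultimately have b: "n + N \<le> b" "b \<le> n + N + R"
      by linarith+
    define u where "u = s / h - real b"
    have u: "0 \<le> u" "u \<le> 1" unfolding u_def rb by linarith+
    have su: "s = h * (real b + u)" using h by (simp add: u_def)
    define j where "j = b - n"
    have j: "b = n + j" "N \<le> j" "j < N + R + 1" using b by (auto simp: j_def)
    have "f s \<le> f (h * real b) + \<kappa>"
      using dropping_block_le[OF f h run[OF j(3)] u] by (simp add: j(1)[symmetric] su)
    also have "\<dots> \<le> f (h * real n) - real j * e + \<kappa>"
      using drop[OF j(3)] j(1) by simp
    also have "\<dots> \<le> f (h * real n) - real N * e + \<kappa>"
      using j(2) e by simp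
    also have "\<dots> < f (h * real n) - a" using N by simp
    also have "f (h * real n) \<le> running_sup f s"
      unfolding running_sup_def
    proof (rule cSUP_upper)
      have "h * real n \<le> h * real (n + N)" using h by simp
      from order_trans[OF this s(1)] h show "h * real n \<in> {0..s}" by auto
    qed (rule cadlag_bdd_above[OF f])
    finally show ?thesis by (simp add: drawdown_def)
  qed
  have tr: "h * real (n + N) + r \<le> t" using r by (simp add: t_def algebra_simps)
  have "0 < h * real (n + N)" using h N by simp
  with tr have "t > r" by linarith
  have "last_time_below a y f t \<le> h * real (n + N)"
  proof -
    have "s \<le> h * real (n + N)" if "s \<in> {s. 0 \<le> s \<and> s \<le> t \<and> drawdown y f s \<le> a}" for s
      using that far[of s] by force
    then show ?thesis
      using h by (auto simp: last_time_below_def Let_def intro!: cSup_least)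
  qed
  then have "t - last_time_below a y f t \<ge> r" using tr by linarith
  then have "parisian_ruin_time a r y f \<le> ereal t"
    using \<open>t > r\<close> unfolding parisian_ruin_time_def by (intro INF_lower) auto
  then show ?thesis by (rule le_less_trans) simp
qed

section \<open>Independence of the blocks of a Levy process\<close>

context levy_process
begin

text \<open>
  The increments over \<open>w\<close> consecutive cells of mesh \<open>\<delta>\<close>, starting with cell \<open>b * w\<close>, form one
  random vector for each block \<open>b\<close>. All these vectors live in the same product space, so that one
  set of vectors describes the same event for every block.
\<close>

definition grid_increments :: "real \<Rightarrow> nat \<Rightarrow> nat \<Rightarrow> 'a \<Rightarrow> nat \<Rightarrow> real" where
  "grid_increments \<delta> w b \<omega> =
     (\<lambda>j\<in>{..<w}. X (\<delta> * real (Suc (b * w + j))) \<omega> - X (\<delta> * real (b * w + j)) \<omega>)"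

lemma measurable_grid_increments:
  assumes "\<delta> \<ge> 0"
  shows "grid_increments \<delta> w b \<in> measurable M (PiM {..<w} (\<lambda>_. borel))"
  unfolding grid_increments_def using assms
  by (intro measurable_restrict borel_measurable_diff measurable_X) auto

lemma indep_grid_increments:
  assumes \<delta>: "\<delta> \<ge> 0"
  shows "indep_vars (\<lambda>_. PiM {..<w} (\<lambda>_. borel)) (grid_increments \<delta> w) {..<m}"
proof -
  define Z where "Z = (\<lambda>i \<omega>. X (\<delta> * real (Suc i)) \<omega> - X (\<delta> * real i) \<omega>)"
  define K where "K b = {b * w..<b * w + w}" for b
  have "indep_vars (\<lambda>_. borel) Z {..<m * w}"
    unfolding Z_def using \<delta> by (intro indep_increments) (auto intro!: mult_left_mono)
  moreover have "K b \<subseteq> {..<m * w}" if "b \<in> {..<m}" for b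
  proof -
    have "Suc b * w \<le> m * w" using that by (intro mult_le_mono1) auto
    then show ?thesis by (auto simp: K_def)
  qed
  moreover have "disjoint_family_on K {..<m}"
  proof -
    have "i div w = b" if "i \<in> K b" for i b
      using that by (intro div_nat_eqI) (auto simp: K_def algebra_simps)
    then show ?thesis unfolding disjoint_family_on_def by (metis disjoint_iff)
  qed
  ultimately have "indep_vars (\<lambda>b. PiM (K b) (\<lambda>_. borel)) (\<lambda>b \<omega>. restrict (\<lambda>i. Z i \<omega>) (K b)) {..<m}"
    by (rule indep_vars_restrict)
  then have "indep_vars (\<lambda>_. PiM {..<w} (\<lambda>_. borel))
      (\<lambda>b \<omega>. (\<lambda>g. \<lambda>j\<in>{..<w}. g (b * w + j)) (restrict (\<lambda>i. Z i \<omega>) (K b))) {..<m}"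
    by (rule indep_vars_compose2)
      (intro measurable_restrict measurable_component_singleton; simp add: K_def)
  also have "(\<lambda>b \<omega>. (\<lambda>g. \<lambda>j\<in>{..<w}. g (b * w + j)) (restrict (\<lambda>i. Z i \<omega>) (K b))) = grid_increments \<delta> w"
    by (auto simp: fun_eq_iff grid_increments_def K_def Z_def)
  finally show ?thesis .
qed

text \<open>
  Stationarity is given for single increments only; independence within the block turns it into
  stationarity of the joint law.
\<close>

lemma distr_grid_increments:
  assumes \<delta>: "\<delta> \<ge> 0" and w: "w > 0"
  shows "distr M (PiM {..<w} (\<lambda>_. borel)) (grid_increments \<delta> w b) =
         PiM {..<w} (\<lambda>_. distr M borel (\<lambda>\<omega>. X \<delta> \<omega> - X 0 \<omega>))"
proof -
  define t where "t j = \<delta> * real (b * w + j)" for j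
  have t0: "t j \<ge> 0" for j using \<delta> by (simp add: t_def)
  have "indep_vars (\<lambda>_. borel) (\<lambda>j \<omega>. X (t (Suc j)) \<omega> - X (t j) \<omega>) {..<w}"
    using \<delta> t0 by (intro indep_increments) (auto simp: t_def intro!: mult_left_mono)
  moreover have "random_variable borel (\<lambda>\<omega>. X (t (Suc j)) \<omega> - X (t j) \<omega>)" for j
    by (intro borel_measurable_diff measurable_X t0)
  ultimately have "distr M (PiM {..<w} (\<lambda>_. borel)) (\<lambda>\<omega>. \<lambda>j\<in>{..<w}. X (t (Suc j)) \<omega> - X (t j) \<omega>) =
      PiM {..<w} (\<lambda>j. distr M borel (\<lambda>\<omega>. X (t (Suc j)) \<omega> - X (t j) \<omega>))"
    using w by (subst (asm) indep_vars_iff_distr_eq_PiM) auto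
  also have "\<dots> = PiM {..<w} (\<lambda>_. distr M borel (\<lambda>\<omega>. X \<delta> \<omega> - X 0 \<omega>))"
    using stationary_increments[OF t0 \<delta>] by (simp add: t_def algebra_simps)
  also have "(\<lambda>\<omega>. \<lambda>j\<in>{..<w}. X (t (Suc j)) \<omega> - X (t j) \<omega>) = grid_increments \<delta> w b"
    by (simp add: grid_increments_def t_def fun_eq_iff)
  finally show ?thesis .
qed

lemma prob_grid_increments:
  assumes \<delta>: "\<delta> \<ge> 0" and w: "w > 0" and C: "C \<in> sets (PiM {..<w} (\<lambda>_. borel))"
  shows "prob (grid_increments \<delta> w b -` C \<inter> space M) = prob (grid_increments \<delta> w 0 -` C \<inter> space M)"
proof -
  have "prob (grid_increments \<delta> w b -` C \<inter> space M) =
        measure (distr M (PiM {..<w} (\<lambda>_. borel)) (grid_increments \<delta> w b)) C" for b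
    using measurable_grid_increments[OF \<delta>] C by (subst measure_distr) auto
  then show ?thesis
    using distr_grid_increments[OF \<delta> w] by metis
qed

lemma prob_Inter_grid_increments:
  assumes \<delta>: "\<delta> \<ge> 0" and w: "w > 0" and C: "C \<in> sets (PiM {..<w} (\<lambda>_. borel))"
    and J: "finite J" "J \<noteq> {}"
  shows "prob (\<Inter>b\<in>J. grid_increments \<delta> w b -` C \<inter> space M) =
         prob (grid_increments \<delta> w 0 -` C \<inter> space M) ^ card J"
proof -
  obtain m where "J \<subseteq> {..<m}" using finite_nat_iff_bounded J by auto
  then have "prob (\<Inter>b\<in>J. grid_increments \<delta> w b -` C \<inter> space M) =
        (\<Prod>b\<in>J. prob (grid_increments \<delta> w b -` C \<inter> space M))"
    using J C by (intro indep_varsD[OF indep_grid_increments[OF \<delta>]]) auto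
  also have "\<dots> = (\<Prod>b\<in>J. prob (grid_increments \<delta> w 0 -` C \<inter> space M))"
    by (intro prod.cong refl prob_grid_increments[OF \<delta> w C])
  finally show ?thesis by simp
qed

abbreviation dropping_event :: "real \<Rightarrow> real \<Rightarrow> real \<Rightarrow> nat \<Rightarrow> 'a set" where
  "dropping_event h e \<kappa> b \<equiv> {\<omega>\<in>space M. dropping_block h e \<kappa> b (\<lambda>t. X t \<omega>)}"

abbreviation dropping_event_at :: "nat \<Rightarrow> real \<Rightarrow> real \<Rightarrow> real \<Rightarrow> nat \<Rightarrow> 'a set" where
  "dropping_event_at k h e \<kappa> b \<equiv> {\<omega>\<in>space M. dropping_at_level k h e \<kappa> b (\<lambda>t. X t \<omega>)}"

text \<open>
  The displacements of the path within a block are the partial sums of the grid increments.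
\<close>

lemma dropping_event_at_eq:
  fixes h e \<kappa> :: real and k :: nat
  defines "w \<equiv> 2 ^ k"
  defines "C \<equiv> {g \<in> space (PiM {..<w} (\<lambda>_. borel)).
      (\<forall>i\<in>{..w}. (\<Sum>j<i. g j) \<le> \<kappa>) \<and> (\<Sum>j<w. g j) < - e}"
  shows "dropping_event_at k h e \<kappa> b = grid_increments (h / w) w b -` C \<inter> space M"
    and "C \<in> sets (PiM {..<w} (\<lambda>_. borel))"
proof -
  have w: "w > 0" by (simp add: w_def)
  have mesh: "h / w * real (b * w + i) = h * (real b + real i / w)" for i
    using w by (simp add: field_simps)
  have sum: "(\<Sum>j<i. grid_increments (h / w) w b \<omega> j) =
      X (h * (real b + real i / w)) \<omega> - X (h * real b) \<omega>" if "i \<le> w" for i \<omega>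
  proof -
    have "(\<Sum>j<i. grid_increments (h / w) w b \<omega> j) =
        (\<Sum>j<i. X (h / w * real (b * w + Suc j)) \<omega> - X (h / w * real (b * w + j)) \<omega>)"
      using that by (intro sum.cong) (auto simp: grid_increments_def)
    also have "\<dots> = X (h / w * real (b * w + i)) \<omega> - X (h / w * real (b * w + 0)) \<omega>"
      by (rule sum_lessThan_telescope)
    finally show ?thesis
      unfolding mesh by simp
  qed
  have sp: "grid_increments (h / w) w b \<omega> \<in> space (PiM {..<w} (\<lambda>_. borel))" for \<omega>
    by (simp add: grid_increments_def space_PiM)
  have "(\<Sum>j<w. grid_increments (h / w) w b \<omega> j) = X (h * (real b + 1)) \<omega> - X (h * real b) \<omega>" for \<omega>
    using sum[of w \<omega>] w by simp
  with sum sp show "dropping_event_at k h e \<kappa> b = grid_increments (h / w) w b -` C \<inter> space M"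
    by (auto simp: dropping_at_level_def C_def w_def)
  have "(\<lambda>g. \<Sum>j<i. g j) \<in> borel_measurable (PiM {..<w} (\<lambda>_. borel :: real measure))" if "i \<le> w" for i
    using that by (intro borel_measurable_sum measurable_component_singleton) auto
  then show "C \<in> sets (PiM {..<w} (\<lambda>_. borel))"
    unfolding C_def by (intro sets.sets_Collect sets.sets_Collect_finite_All) auto
qed

lemma dropping_event_eq: "dropping_event h e \<kappa> b = (\<Inter>k. dropping_event_at k h e \<kappa> b)"
  by (auto simp: dropping_block_def)

lemma sets_dropping_event_at [measurable]: "h \<ge> 0 \<Longrightarrow> dropping_event_at k h e \<kappa> b \<in> events"
  unfolding dropping_event_at_eq(1)
  by (intro measurable_sets[OF measurable_grid_increments] dropping_event_at_eq(2)) auto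

lemma sets_dropping_event [measurable]: "h \<ge> 0 \<Longrightarrow> dropping_event h e \<kappa> b \<in> events"
  unfolding dropping_event_eq by (intro sets.countable_INT) auto

lemma decseq_dropping_event_at: "decseq (\<lambda>k. dropping_event_at k h e \<kappa> b)"
  using dropping_at_level_Suc by (auto intro!: decseq_SucI)

text \<open>
  The product formula holds at each level \<open>k\<close>; both sides converge as \<open>k\<close> grows.
\<close>

lemma prob_Inter_dropping_event:
  assumes h: "h \<ge> 0" and J: "finite J" "J \<noteq> {}"
  shows "prob (\<Inter>b\<in>J. dropping_event h e \<kappa> b) = prob (dropping_event h e \<kappa> 0) ^ card J"
proof (rule LIMSEQ_unique)
  have "decseq (\<lambda>k. \<Inter>b\<in>J. dropping_event_at k h e \<kappa> b)"
    using decseq_dropping_event_at[of h e \<kappa>] unfolding decseq_def by blast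
  then have "(\<lambda>k. prob (\<Inter>b\<in>J. dropping_event_at k h e \<kappa> b)) \<longlonglongrightarrow>
      prob (\<Inter>k. \<Inter>b\<in>J. dropping_event_at k h e \<kappa> b)"
    using h J by (intro finite_Lim_measure_decseq) (auto intro!: sets.finite_INT)
  also have "(\<Inter>k. \<Inter>b\<in>J. dropping_event_at k h e \<kappa> b) = (\<Inter>b\<in>J. dropping_event h e \<kappa> b)"
    unfolding dropping_event_eq by blast
  finally show "(\<lambda>k. prob (\<Inter>b\<in>J. dropping_event_at k h e \<kappa> b)) \<longlonglongrightarrow>
      prob (\<Inter>b\<in>J. dropping_event h e \<kappa> b)" .
  have "(\<lambda>k. prob (dropping_event_at k h e \<kappa> 0)) \<longlonglongrightarrow> prob (dropping_event h e \<kappa> 0)"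
    unfolding dropping_event_eq using h
    by (intro finite_Lim_measure_decseq decseq_dropping_event_at) auto
  then have "(\<lambda>k. prob (dropping_event_at k h e \<kappa> 0) ^ card J) \<longlonglongrightarrow>
      prob (dropping_event h e \<kappa> 0) ^ card J"
    by (intro tendsto_power)
  also have "(\<lambda>k. prob (dropping_event_at k h e \<kappa> 0) ^ card J) =
      (\<lambda>k. prob (\<Inter>b\<in>J. dropping_event_at k h e \<kappa> b))"
    unfolding dropping_event_at_eq(1)
    using h J by (intro ext prob_Inter_grid_increments[symmetric] dropping_event_at_eq(2)) auto
  finally show "(\<lambda>k. prob (\<Inter>b\<in>J. dropping_event_at k h e \<kappa> b)) \<longlonglongrightarrow>
      prob (dropping_event h e \<kappa> 0) ^ card J" .
qed

lemma prob_dropping_event: "h \<ge> 0 \<Longrightarrow> prob (dropping_event h e \<kappa> b) = prob (dropping_event h e \<kappa> 0)"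
  using prob_Inter_dropping_event[of h "{b}" e \<kappa>] by simp

lemma indep_dropping_event:
  assumes h: "h \<ge> 0"
  shows "indep_events (dropping_event h e \<kappa>) UNIV"
proof (rule indep_eventsI)
  fix J :: "nat set" assume J: "finite J" "J \<noteq> {}"
  have "prob (\<Inter>b\<in>J. dropping_event h e \<kappa> b) = (\<Prod>b\<in>J. prob (dropping_event h e \<kappa> 0))"
    using prob_Inter_dropping_event[OF h J] by simp
  also have "\<dots> = (\<Prod>b\<in>J. prob (dropping_event h e \<kappa> b))"
    by (intro prod.cong refl prob_dropping_event[OF h, symmetric])
  finally show "prob (\<Inter>b\<in>J. dropping_event h e \<kappa> b) = (\<Prod>b\<in>J. prob (dropping_event h e \<kappa> b))" .
qed (rule sets_dropping_event[OF h])

end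

section \<open>Dropping blocks have positive probability\<close>

lemma mono_on_if_mono_on_rats:
  assumes f: "cadlag f"
    and rat: "\<And>p q. 0 \<le> p \<Longrightarrow> p \<le> q \<Longrightarrow> f (of_rat p) \<le> f (of_rat q)"
  shows "mono_on {0..} f"
proof (rule mono_onI, rule ccontr)
  fix s t :: real
  assume s: "s \<in> {0..}" and "t \<in> {0..}" "s \<le> t" and neg: "\<not> f s \<le> f t"
  then have "s < t" by (cases "s = t") auto
  have lim: "(f \<longlongrightarrow> f u) (at_right u)" if "u \<ge> 0" for u
    using f that by (auto simp: cadlag_def continuous_within)
  define m where "m = (f s + f t) / 2"
  have "\<forall>\<^sub>F u in at_right s. f u > m" "\<forall>\<^sub>F u in at_right t. f u < m"
    using neg s \<open>s < t\<close> by (intro order_tendstoD[OF lim]; simp add: m_def)+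
  then obtain c d where c: "c > s" "\<And>u. s < u \<Longrightarrow> u < c \<Longrightarrow> f u > m"
    and d: "d > t" "\<And>u. t < u \<Longrightarrow> u < d \<Longrightarrow> f u < m"
    by (auto simp: eventually_at_right_field)
  obtain p where p: "s < of_rat p" "of_rat p < min c t"
    using of_rat_dense[of s "min c t"] c \<open>s < t\<close> by auto
  obtain q where q: "t < of_rat q" "of_rat q < d"
    using of_rat_dense[of t d] d by auto
  have "of_rat p < (of_rat q :: real)" using p q by simp
  moreover have "0 < (of_rat p :: real)" using p(1) s unfolding atLeast_iff by linarith
  ultimately have "0 \<le> p" "p \<le> q" by (simp_all add: of_rat_less zero_less_of_rat_iff)
  with rat[of p q] c(2)[of "of_rat p"] d(2)[of "of_rat q"] p q show False by fastforce
qed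

context levy_process
begin

text \<open>
  Otherwise all increments are almost surely nonnegative, simultaneously for the countably many
  pairs of rational times, and right-continuity makes the paths increasing.
\<close>

lemma ex_negative_increment:
  assumes "\<not> (AE \<omega> in M. mono_on {0..} (\<lambda>t. X t \<omega>))"
  shows "\<exists>h>0. \<exists>e>0. prob {\<omega>\<in>space M. X h \<omega> - X 0 \<omega> < - e} > 0"
proof (rule ccontr)
  assume neg: "\<not> ?thesis"
  have [measurable]: "X t \<in> borel_measurable M" if "t \<ge> 0" for t
    using that by (rule measurable_X)
  have start: "AE \<omega> in M. 0 \<le> X h \<omega> - X 0 \<omega>" if h: "h \<ge> 0" for h
  proof (cases "h = 0")
    case False
    have "AE \<omega> in M. \<not> X h \<omega> - X 0 \<omega> < - (1 / real (Suc n))" for n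
    proof -
      have "prob {\<omega>\<in>space M. X h \<omega> - X 0 \<omega> < - (1 / real (Suc n))} = 0"
        using neg[simplified, rule_format, of h "1 / real (Suc n)"] h False
        by (auto simp: not_less measure_le_0_iff)
      then show ?thesis
        using h by (subst (asm) prob_eq_0) auto
    qed
    then have "AE \<omega> in M. \<forall>n. \<not> X h \<omega> - X 0 \<omega> < - (1 / real (Suc n))"
      by (subst AE_all_countable) auto
    then show ?thesis
    proof eventually_elim
      case (elim \<omega>)
      show ?case
      proof (rule ccontr)
        assume "\<not> 0 \<le> X h \<omega> - X 0 \<omega>"
        then obtain n where "inverse (real (Suc n)) < X 0 \<omega> - X h \<omega>"
          using reals_Archimedean[of "X 0 \<omega> - X h \<omega>"] by auto
        with elim show False by (auto simp: inverse_eq_divide dest!: spec[of _ n])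
      qed
    qed
  qed auto
  have incr: "AE \<omega> in M. X s \<omega> \<le> X t \<omega>" if "0 \<le> s" "s \<le> t" for s t
  proof -
    have "AE z in distr M borel (\<lambda>\<omega>. X (t - s) \<omega> - X 0 \<omega>). 0 \<le> z"
      using start[of "t - s"] that by (subst AE_distr_iff) auto
    also have "distr M borel (\<lambda>\<omega>. X (t - s) \<omega> - X 0 \<omega>) = distr M borel (\<lambda>\<omega>. X t \<omega> - X s \<omega>)"
      using stationary_increments[of s "t - s"] that by simp
    finally show ?thesis
      using that by (subst (asm) AE_distr_iff) auto
  qed
  have "AE \<omega> in M. 0 \<le> p \<longrightarrow> p \<le> q \<longrightarrow> X (of_rat p) \<omega> \<le> X (of_rat q) \<omega>" for p q
    using incr[of "of_rat p" "of_rat q"] by (cases "0 \<le> p \<and> p \<le> q") (auto simp: of_rat_less_eq)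
  then have "AE \<omega> in M. \<forall>p q. 0 \<le> p \<longrightarrow> p \<le> q \<longrightarrow> X (of_rat p) \<omega> \<le> X (of_rat q) \<omega>"
    by (simp add: AE_all_countable)
  with cadlag_paths have "AE \<omega> in M. mono_on {0..} (\<lambda>t. X t \<omega>)"
    by eventually_elim (auto intro: mono_on_if_mono_on_rats)
  with assms show False by simp
qed

text \<open>
  As \<open>\<kappa>\<close> grows, the dropping events for block \<open>0\<close> exhaust the event that \<open>X h - X 0 < - e\<close>, since
  almost every path is bounded above on \<open>{0..h}\<close>.
\<close>

lemma ex_dropping_event_pos:
  assumes h: "h \<ge> 0" and pos: "prob {\<omega>\<in>space M. X h \<omega> - X 0 \<omega> < - e} > 0"
  shows "\<exists>\<kappa>. prob (dropping_event h e \<kappa> 0) > 0"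
proof (rule ccontr)
  assume "\<not> ?thesis"
  then have zero: "prob (dropping_event h e \<kappa> 0) = 0" for \<kappa>
    by (auto simp: not_less measure_le_0_iff)
  have "incseq (\<lambda>n. dropping_event h e (real n) 0)"
    by (force simp: incseq_def dropping_block_def dropping_at_level_def)
  then have "(\<lambda>n. prob (dropping_event h e (real n) 0)) \<longlonglongrightarrow>
      prob (\<Union>n. dropping_event h e (real n) 0)"
    using sets_dropping_event[OF h] by (intro finite_Lim_measure_incseq) auto
  then have "prob (\<Union>n. dropping_event h e (real n) 0) = 0"
    unfolding zero by (simp add: LIMSEQ_const_iff)
  moreover have "prob {\<omega>\<in>space M. X h \<omega> - X 0 \<omega> < - e} \<le>
      prob (\<Union>n. dropping_event h e (real n) 0)"
  proof (rule finite_measure_mono_AE)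
    show "AE \<omega> in M. \<omega> \<in> {\<omega>\<in>space M. X h \<omega> - X 0 \<omega> < - e} \<longrightarrow>
        \<omega> \<in> (\<Union>n. dropping_event h e (real n) 0)"
      using cadlag_paths
    proof eventually_elim
      case (elim \<omega>)
      obtain B where B: "\<And>s. s \<in> {0..h} \<Longrightarrow> X s \<omega> \<le> B"
        using cadlag_bdd_above[OF elim, of h] unfolding bdd_above_def by blast
      obtain n :: nat where n: "B - X 0 \<omega> \<le> real n"
        using real_arch_simple by blast
      have "X (h * (real i / 2 ^ k)) \<omega> - X 0 \<omega> \<le> real n" if "i \<le> 2 ^ k" for i k
      proof -
        have "real i / 2 ^ k \<le> 1" using that by (simp add: divide_le_eq)
        then have "h * (real i / 2 ^ k) \<in> {0..h}"
          using h mult_left_mono[of "real i / 2 ^ k" 1 h] by auto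
        from B[OF this] n show ?thesis by linarith
      qed
      then show ?case
        by (auto simp: dropping_block_def dropping_at_level_def)
    qed
  qed (use sets_dropping_event[OF h] in auto)
  ultimately show False using pos by simp
qed

end

section \<open>Certainty of Parisian ruin\<close>

theorem corollary2p2:
  fixes M :: "'a measure" and X :: "real \<Rightarrow> 'a \<Rightarrow> real"
    and \<mu> \<sigma> :: real and \<nu> :: "real measure"
    and a r x y :: real
  assumes "spectrally_negative_levy_process M X \<mu> \<sigma> \<nu>"
    and "a > 0"
    and "r \<ge> 0"
    and "y \<ge> x"
    and "AE \<omega> in M. X 0 \<omega> = x"
  shows "AE \<omega> in M. parisian_ruin_time a r y (\<lambda>t. X t \<omega>) < \<infinity>"
proof -
  interpret spectrally_negative_levy_process M X \<mu> \<sigma> \<nu> by fact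
  obtain h e where h: "h > 0" and e: "e > 0"
    and pos: "prob {\<omega>\<in>space M. X h \<omega> - X 0 \<omega> < - e} > 0"
    using ex_negative_increment[OF not_increasing] by blast
  then obtain \<kappa> where \<kappa>: "prob (dropping_event h e \<kappa> 0) > 0"
    using ex_dropping_event_pos[of h e] by auto
  \<comment> \<open>\<open>\<kappa> + a\<close> may be negative; the larger bound makes \<open>N\<close> positive, which gives \<open>t > r\<close>
    in the definition of the ruin time.\<close>
  obtain N :: nat where "(\<bar>\<kappa> + a\<bar> + 1) / e < real N"
    using reals_Archimedean2 by blast
  then have N': "\<bar>\<kappa> + a\<bar> + 1 < real N * e" using e by (simp add: field_simps)
  then have N: "N > 0" "\<kappa> + a < real N * e" by (cases "N = 0"; auto)+
  obtain R :: nat where "r / h \<le> real R"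
    using real_arch_simple by blast
  then have R: "r \<le> h * real R" using h by (simp add: field_simps)
  have "AE \<omega> in M. \<exists>n. \<forall>i<N + R + 1. \<omega> \<in> dropping_event h e \<kappa> (n + i)"
  proof (rule indep_events_run[OF _ \<kappa>])
    show "indep_events (dropping_event h e \<kappa>) UNIV"
      using h by (intro indep_dropping_event) simp
    show "prob (dropping_event h e \<kappa> 0) \<le> prob (dropping_event h e \<kappa> b)" for b
      by (rule eq_refl[OF prob_dropping_event[OF less_imp_le[OF h], symmetric]])
  qed
  with cadlag_paths show ?thesis
  proof eventually_elim
    case (elim \<omega>)
    then show ?case
      using parisian_ruin_of_run[OF elim(1) h e R N] by blast
  qed
qed

end
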